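(* For every $n\ge2$, $E_{\min}(\omega^n)\ \le_c\ \cong_{\mathcal{CS}_n}$.
   Context: $W_e$ denotes the $e$-th c.e. set. $\mathcal{CS}$ is the variety of commutative semigroups. For $n\ge1$, $X_n=\{x_0,\dots,x_{n-1}\}$; fix a computable bijective coding of pairs of terms over $X_n$ by natural numbers. $\mathcal{CS}_n[e]$ is the term algebra over $X_n$ modulo the smallest congruence containing the pairs coded in $W_e$ and all instances of the commutative semigroup laws; $e\cong_{\mathcal{CS}_n}i$ iff $\mathcal{CS}_n[e]\cong\mathcal{CS}_n[i]$. For an ordinal $\alpha\le\omega^\omega$, fix a computable bijection $h$ from the ordinals $<\alpha$ (Cantor normal forms $\omega^{e_1}c_1+\dots+\omega^{e_k}c_k$ coded as finite tuples of naturals) onto $\mathbb N$, let $n\le_\alpha m$ iff $h^{-1}(n)\le h^{-1}(m)$, and let $e\,E_{\min}(\alpha)\,i$ iff $W_e,W_i$ are both empty or have the same $\le_\alpha$-least element. $E\le_c F$ means there is a total computable $h$ with $x\,E\,y\iff h(x)\,F\,h(y)$. *)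

theory Defs
  imports Main "HOL-Library.Nat_Bijection"
begin

section \<open>Computable functions and c.e. sets\<close>

text \<open>Programs for the partial computable functions of one argument. Several arguments are
  passed through the Cantor pairing \<^const>\<open>prod_encode\<close>.\<close>

datatype prog =
    Zero | Succ | Fst | Snd
  | Tup prog prog | Comp prog prog | PrimRec prog prog | Mu prog

text \<open>\<open>PrimRec f g\<close> at \<open>(a, y)\<close> is primitive recursion on \<open>y\<close> with parameter \<open>a\<close>;
  \<open>Mu f\<close> at \<open>x\<close> is the least zero \<open>m\<close> of \<open>\<lambda>m. f (x, m)\<close>, provided that \<open>f\<close> is defined
  at all smaller arguments. \<^const>\<open>None\<close> means divergence.\<close>

primrec eval_prog :: "prog \<Rightarrow> nat \<Rightarrow> nat option" where
  "eval_prog Zero = (\<lambda>x. Some 0)"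
| "eval_prog Succ = (\<lambda>x. Some (Suc x))"
| "eval_prog Fst = (\<lambda>x. Some (fst (prod_decode x)))"
| "eval_prog Snd = (\<lambda>x. Some (snd (prod_decode x)))"
| "eval_prog (Tup f g) = (\<lambda>x. Option.bind (eval_prog f x)
     (\<lambda>u. Option.bind (eval_prog g x) (\<lambda>v. Some (prod_encode (u, v)))))"
| "eval_prog (Comp f g) = (\<lambda>x. Option.bind (eval_prog g x) (eval_prog f))"
| "eval_prog (PrimRec f g) = (\<lambda>x. rec_nat (eval_prog f (fst (prod_decode x)))
     (\<lambda>y r. Option.bind r
        (\<lambda>v. eval_prog g (prod_encode (fst (prod_decode x), prod_encode (y, v)))))
     (snd (prod_decode x)))"
| "eval_prog (Mu f) = (\<lambda>x.
     let P = (\<lambda>m. eval_prog f (prod_encode (x, m)) = Some 0 \<and>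
                  (\<forall>k<m. eval_prog f (prod_encode (x, k)) \<noteq> None))
     in if \<exists>m. P m then Some (LEAST m. P m) else None)"

definition computable :: "(nat \<Rightarrow> nat) \<Rightarrow> bool" where
  "computable f \<longleftrightarrow> (\<exists>c. \<forall>x. eval_prog c x = Some (f x))"

primrec prog_num :: "prog \<Rightarrow> nat" where
  "prog_num Zero = 0"
| "prog_num Succ = 1"
| "prog_num Fst = 2"
| "prog_num Snd = 3"
| "prog_num (Tup f g) = 4 + 4 * prod_encode (prog_num f, prog_num g)"
| "prog_num (Comp f g) = 5 + 4 * prod_encode (prog_num f, prog_num g)"
| "prog_num (PrimRec f g) = 6 + 4 * prod_encode (prog_num f, prog_num g)"
| "prog_num (Mu f) = 7 + 4 * prog_num f"

lemma inj_prog_num: "inj prog_num"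
proof (rule injI)
  have neq: "4 * (a::nat) \<noteq> Suc (4 * b)" "4 * a \<noteq> Suc (Suc (4 * b))" "4 * a \<noteq> 3 + 4 * b"
    "Suc (4 * b) \<noteq> 4 * a" "Suc (Suc (4 * b)) \<noteq> 4 * a" "3 + 4 * b \<noteq> 4 * a"
    "Suc (4 * a) \<noteq> 2 + 4 * b" "2 + 4 * b \<noteq> Suc (4 * a)"
    "2 + 4 * a \<noteq> 4 * b" "4 * b \<noteq> 2 + 4 * a" for a b by presburger+
  fix c d show "prog_num c = prog_num d \<Longrightarrow> c = d"
    by (induction c arbitrary: d; case_tac d; auto simp: neq)
qed

lemma surj_prog_num: "surj prog_num"
proof -
  have "\<exists>c. prog_num c = e" for e
  proof (induction e rule: less_induct)
    case (less e)
    show ?case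
    proof (cases "e < 4")
      case True
      then have "e = 0 \<or> e = 1 \<or> e = 2 \<or> e = 3" by auto
      then show ?thesis by (metis prog_num.simps(1-4))
    next
      case False
      define q where "q = (e - 4) div 4"
      have e: "e = 4 + 4 * q \<or> e = 5 + 4 * q \<or> e = 6 + 4 * q \<or> e = 7 + 4 * q"
        and "q < e"
        using False unfolding q_def by presburger+
      obtain a b where ab: "q = prod_encode (a, b)" by (metis prod_decode_inverse surj_pair)
      then have "a \<le> q" "b \<le> q" by (auto simp: le_prod_encode_1 le_prod_encode_2)
      with \<open>q < e\<close> less.IH obtain f g k where
        "prog_num f = a" "prog_num g = b" "prog_num k = q" by (meson le_less_trans)
      with e ab show ?thesis by (metis prog_num.simps(5-8))
    qed
  qed
  then show ?thesis by (metis surjI)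
qed

lemma bij_prog_num: "bij prog_num"
  by (simp add: bij_def inj_prog_num surj_prog_num)

text \<open>\<open>W e\<close> is the domain of the \<open>e\<close>-th partial computable function.\<close>

definition W :: "nat \<Rightarrow> nat set" where
  "W e = dom (eval_prog (inv prog_num e))"

definition computably_reducible ::
    "(nat \<Rightarrow> nat \<Rightarrow> bool) \<Rightarrow> (nat \<Rightarrow> nat \<Rightarrow> bool) \<Rightarrow> bool"  (infix "\<le>\<^sub>c" 50) where
  "E \<le>\<^sub>c F \<longleftrightarrow> (\<exists>h. computable h \<and> (\<forall>x y. E x y \<longleftrightarrow> F (h x) (h y)))"

text \<open>\<open>h\<close> is a computable bijection from \<open>D\<close> onto the natural numbers, where computability
  refers to the injective representation \<open>r\<close> of the finite objects in \<open>D\<close> by numbers.\<close>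

definition computable_bijection :: "('a \<Rightarrow> nat) \<Rightarrow> 'a set \<Rightarrow> ('a \<Rightarrow> nat) \<Rightarrow> bool" where
  "computable_bijection r D h \<longleftrightarrow>
     bij_betw h D UNIV \<and> (\<exists>f. computable f \<and> (\<forall>x\<in>D. h x = f (r x)))"


section \<open>Ordinals below \<open>\<omega>\<^sup>\<omega>\<close>\<close>

text \<open>The list \<open>[(e\<^sub>1, c\<^sub>1), \<dots>, (e\<^sub>k, c\<^sub>k)]\<close> stands for the Cantor normal form
  \<open>\<omega>\<^bsup>e\<^sub>1\<^esup> c\<^sub>1 + \<dots> + \<omega>\<^bsup>e\<^sub>k\<^esup> c\<^sub>k\<close>.\<close>

type_synonym cnf = "(nat \<times> nat) list"

definition is_cnf :: "cnf \<Rightarrow> bool" where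
  "is_cnf a \<longleftrightarrow> sorted_wrt (>) (map fst a) \<and> (\<forall>(e, c)\<in>set a. c > 0)"

text \<open>Normal forms are compared lexicographically, a proper prefix being smaller.\<close>

definition ord_less :: "cnf \<Rightarrow> cnf \<Rightarrow> bool" where
  "ord_less a b \<longleftrightarrow> (a, b) \<in> lexord (less_than <*lex*> less_than)"

definition ord_le :: "cnf \<Rightarrow> cnf \<Rightarrow> bool" where
  "ord_le a b \<longleftrightarrow> ord_less a b \<or> a = b"

definition ordinals_below :: "cnf \<Rightarrow> cnf set" where
  "ordinals_below \<alpha> = {a. is_cnf a \<and> ord_less a \<alpha>}"

definition omega_pow :: "nat \<Rightarrow> cnf" where
  "omega_pow n = [(n, 1)]"

text \<open>The number representing the tuple \<open>(e\<^sub>1, c\<^sub>1, \<dots>, e\<^sub>k, c\<^sub>k)\<close>.\<close>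

definition cnf_num :: "cnf \<Rightarrow> nat" where
  "cnf_num a = list_encode (concat (map (\<lambda>(e, c). [e, c]) a))"


section \<open>The relation \<open>E\<^sub>m\<^sub>i\<^sub>n(\<alpha>)\<close>\<close>

definition le_via :: "cnf \<Rightarrow> (cnf \<Rightarrow> nat) \<Rightarrow> nat \<Rightarrow> nat \<Rightarrow> bool" where
  "le_via \<alpha> h k m \<longleftrightarrow>
     ord_le (inv_into (ordinals_below \<alpha>) h k) (inv_into (ordinals_below \<alpha>) h m)"

definition is_least_via :: "cnf \<Rightarrow> (cnf \<Rightarrow> nat) \<Rightarrow> nat set \<Rightarrow> nat \<Rightarrow> bool" where
  "is_least_via \<alpha> h A m \<longleftrightarrow> m \<in> A \<and> (\<forall>k\<in>A. le_via \<alpha> h m k)"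

definition E_min :: "cnf \<Rightarrow> (cnf \<Rightarrow> nat) \<Rightarrow> nat \<Rightarrow> nat \<Rightarrow> bool" where
  "E_min \<alpha> h e i \<longleftrightarrow>
     W e = {} \<and> W i = {} \<or>
     (\<exists>m. is_least_via \<alpha> h (W e) m \<and> is_least_via \<alpha> h (W i) m)"


section \<open>C.e. presentations of commutative semigroups\<close>

datatype sterm = Var nat | Times sterm sterm

primrec vars :: "sterm \<Rightarrow> nat set" where
  "vars (Var i) = {i}"
| "vars (Times s t) = vars s \<union> vars t"

definition terms_over :: "nat \<Rightarrow> sterm set" where
  "terms_over n = {t. vars t \<subseteq> {..<n}}"

primrec sterm_num :: "sterm \<Rightarrow> nat" where
  "sterm_num (Var i) = 2 * i"
| "sterm_num (Times s t) = 2 * prod_encode (sterm_num s, sterm_num t) + 1"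

definition sterm_pair_num :: "sterm \<times> sterm \<Rightarrow> nat" where
  "sterm_pair_num = (\<lambda>(s, t). prod_encode (sterm_num s, sterm_num t))"

definition congruence_on :: "nat \<Rightarrow> (sterm \<times> sterm) set \<Rightarrow> bool" where
  "congruence_on n r \<longleftrightarrow> equiv (terms_over n) r \<and>
     (\<forall>s s' t t'. (s, s') \<in> r \<and> (t, t') \<in> r \<longrightarrow> (Times s t, Times s' t') \<in> r)"

definition CS_laws :: "nat \<Rightarrow> (sterm \<times> sterm) set" where
  "CS_laws n =
     {(Times (Times s t) u, Times s (Times t u)) | s t u.
        s \<in> terms_over n \<and> t \<in> terms_over n \<and> u \<in> terms_over n} \<union>
     {(Times s t, Times t s) | s t. s \<in> terms_over n \<and> t \<in> terms_over n}"

text \<open>The parameter \<open>p\<close> below is the coding of pairs of terms over \<open>X\<^sub>n\<close> by numbers.\<close>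

definition coded_pairs :: "nat \<Rightarrow> (sterm \<times> sterm \<Rightarrow> nat) \<Rightarrow> nat \<Rightarrow> (sterm \<times> sterm) set" where
  "coded_pairs n p e = {q \<in> terms_over n \<times> terms_over n. p q \<in> W e}"

definition CS_cong :: "nat \<Rightarrow> (sterm \<times> sterm \<Rightarrow> nat) \<Rightarrow> nat \<Rightarrow> (sterm \<times> sterm) set" where
  "CS_cong n p e = \<Inter> {r. congruence_on n r \<and> coded_pairs n p e \<union> CS_laws n \<subseteq> r}"

definition CS_carrier :: "nat \<Rightarrow> (sterm \<times> sterm \<Rightarrow> nat) \<Rightarrow> nat \<Rightarrow> sterm set set" where
  "CS_carrier n p e = terms_over n // CS_cong n p e"

text \<open>As \<^term>\<open>CS_cong n p e\<close> is a congruence, the union ranges over copies of one class.\<close>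

definition CS_mult ::
    "nat \<Rightarrow> (sterm \<times> sterm \<Rightarrow> nat) \<Rightarrow> nat \<Rightarrow> sterm set \<Rightarrow> sterm set \<Rightarrow> sterm set" where
  "CS_mult n p e A B = (\<Union>s\<in>A. \<Union>t\<in>B. CS_cong n p e `` {Times s t})"

definition semigroup_isomorphic ::
    "'a set \<Rightarrow> ('a \<Rightarrow> 'a \<Rightarrow> 'a) \<Rightarrow> 'b set \<Rightarrow> ('b \<Rightarrow> 'b \<Rightarrow> 'b) \<Rightarrow> bool" where
  "semigroup_isomorphic A f B g \<longleftrightarrow>
     (\<exists>\<phi>. bij_betw \<phi> A B \<and> (\<forall>x\<in>A. \<forall>y\<in>A. \<phi> (f x y) = g (\<phi> x) (\<phi> y)))"

definition CS_iso :: "nat \<Rightarrow> (sterm \<times> sterm \<Rightarrow> nat) \<Rightarrow> nat \<Rightarrow> nat \<Rightarrow> bool" where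
  "CS_iso n p e i \<longleftrightarrow>
     semigroup_isomorphic (CS_carrier n p e) (CS_mult n p e) (CS_carrier n p i) (CS_mult n p i)"

end

theory Submission
  imports Defs
begin

text \<open>Identify an ordinal below \<open>\<omega>\<^sup>n\<close> with its coefficient vector, so that the order becomes the
  lexicographic order on \<open>\<nat>\<^sup>n\<close>. The exponent vectors that are lexicographically above a given one
  form an ideal of the free commutative semigroup, and these ideals shrink as the ordinal grows.
  Enumerating \<open>\<beta>\<close> into \<open>W e\<close> collapses the ideal of \<open>\<beta>\<close> to a zero; all of \<open>W e\<close> then collapses
  the ideal of its least element. Conversely, a semigroup \<open>S\<close> determines the numbers
  \<open>|S\<^sup>d - S\<^bsup>d+1\<^esup>|\<close>, which here count the vectors of degree \<open>d\<close> outside the ideal; as the ideals form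
  a chain, these finite numbers determine the ideal.\<close>

section \<open>Computable functions\<close>

lemma computable_comp:
  assumes "computable f" and "computable g"
  shows "computable (\<lambda>x. f (g x))"
proof -
  obtain c d where "\<And>x. eval_prog c x = Some (f x)" "\<And>x. eval_prog d x = Some (g x)"
    using assms unfolding computable_def by blast
  then have "\<forall>x. eval_prog (Comp c d) x = Some (f (g x))" by simp
  then show ?thesis unfolding computable_def by blast
qed

lemma computable_id: "computable (\<lambda>x. x)"
  unfolding computable_def by (rule exI[of _ "Tup Fst Snd"]) simp

lemma computable_Suc: "computable f \<Longrightarrow> computable (\<lambda>x. Suc (f x))"
  by (rule computable_comp[of Suc]) (auto simp: computable_def intro: exI[of _ Succ])

lemma computable_fst: "computable f \<Longrightarrow> computable (\<lambda>x. fst (prod_decode (f x)))"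
  by (rule computable_comp[of "\<lambda>x. fst (prod_decode x)"])
    (auto simp: computable_def intro: exI[of _ Fst])

lemma computable_snd: "computable f \<Longrightarrow> computable (\<lambda>x. snd (prod_decode (f x)))"
  by (rule computable_comp[of "\<lambda>x. snd (prod_decode x)"])
    (auto simp: computable_def intro: exI[of _ Snd])

lemma computable_const: "computable (\<lambda>x. k)"
proof (induction k)
  case 0
  show ?case unfolding computable_def by (rule exI[of _ Zero]) simp
qed (rule computable_Suc)

lemma computable_pair:
  assumes "computable f" and "computable g"
  shows "computable (\<lambda>x. prod_encode (f x, g x))"
proof -
  obtain c d where "\<And>x. eval_prog c x = Some (f x)" "\<And>x. eval_prog d x = Some (g x)"
    using assms unfolding computable_def by blast
  then have "\<forall>x. eval_prog (Tup c d) x = Some (prod_encode (f x, g x))" by simp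
  then show ?thesis unfolding computable_def by blast
qed

text \<open>The whole input \<open>x\<close> serves as the parameter of \<open>PrimRec\<close> and
  \<open>y x\<close> as its counter, so base and step may both depend on \<open>x\<close>.\<close>

lemma computable_rec:
  assumes b: "computable b"
    and s: "computable (\<lambda>x. s (fst (prod_decode x)) (fst (prod_decode (snd (prod_decode x))))
              (snd (prod_decode (snd (prod_decode x)))))"
    and y: "computable y"
  shows "computable (\<lambda>x. rec_nat (b x) (s x) (y x))"
proof -
  obtain cb where cb: "\<And>x. eval_prog cb x = Some (b x)"
    using b unfolding computable_def by blast
  obtain cs where cs: "\<And>x k r. eval_prog cs (prod_encode (x, prod_encode (k, r))) = Some (s x k r)"
    using s unfolding computable_def by (metis fst_conv snd_conv prod_encode_inverse)
  have "eval_prog (PrimRec cb cs) x =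
      Some (rec_nat (b (fst (prod_decode x))) (s (fst (prod_decode x))) (snd (prod_decode x)))" for x
  proof -
    have "rec_nat (Some (b a)) (\<lambda>k r. Option.bind r (\<lambda>v. eval_prog cs (prod_encode (a, prod_encode (k, v))))) m
        = Some (rec_nat (b a) (s a) m)" for a m
      by (induction m) (simp_all add: cs)
    then show ?thesis by (simp add: cb)
  qed
  then have "computable
      (\<lambda>x. rec_nat (b (fst (prod_decode x))) (s (fst (prod_decode x))) (snd (prod_decode x)))"
    unfolding computable_def by blast
  from computable_comp[OF this computable_pair[OF computable_id y]] show ?thesis by simp
qed

lemma computable_add:
  assumes "computable f" and "computable g"
  shows "computable (\<lambda>x. f x + g x)"
proof -
  have "computable (\<lambda>x. rec_nat (f x) (\<lambda>_. Suc) (g x))"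
    by (intro computable_rec assms computable_Suc computable_snd computable_id)
  moreover have "rec_nat a (\<lambda>_. Suc) b = a + b" for a b by (induction b) simp_all
  ultimately show ?thesis by simp
qed

lemma computable_diff:
  assumes "computable f" and "computable g"
  shows "computable (\<lambda>x. f x - g x)"
proof -
  have "computable (\<lambda>x. rec_nat 0 (\<lambda>k _. k) x)"
    by (intro computable_rec computable_const computable_fst computable_snd computable_id)
  moreover have "rec_nat 0 (\<lambda>k _. k) x = x - 1" for x :: nat by (cases x) simp_all
  ultimately have pred: "computable (\<lambda>x. x - 1)" by simp
  have "computable (\<lambda>x. rec_nat (f x) (\<lambda>_ r. r - 1) (g x))"
    by (intro computable_rec assms computable_comp[OF pred] computable_snd computable_id)
  moreover have "rec_nat a (\<lambda>_ r. r - 1) b = a - b" for a b :: nat by (induction b) simp_all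
  ultimately show ?thesis by simp
qed

section \<open>Decidable predicates and unbounded search\<close>

definition decidable :: "(nat \<Rightarrow> bool) \<Rightarrow> bool" where
  "decidable P \<longleftrightarrow> computable (\<lambda>x. if P x then 0 else 1)"

text \<open>A case distinction is a recursion whose step ignores both the counter and the previous
  value.\<close>

lemma computable_if_zero:
  assumes "computable f" and "computable g" and "computable k"
  shows "computable (\<lambda>x. if f x = 0 then g x else k x)"
proof -
  have "computable (\<lambda>x. rec_nat (g x) (\<lambda>_ _. k x) (f x))"
    by (intro computable_rec assms computable_comp[OF assms(3)] computable_fst computable_id)
  moreover have "rec_nat a (\<lambda>_ _. b) c = (if c = 0 then a else b)" for a b :: nat and c
    by (cases c) simp_all
  ultimately show ?thesis by simp
qed

lemma computable_if:
  assumes "decidable P" and "computable f" and "computable g"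
  shows "computable (\<lambda>x. if P x then f x else g x)"
proof -
  have "(\<lambda>x. if (if P x then 0 else 1::nat) = 0 then f x else g x) = (\<lambda>x. if P x then f x else g x)"
    by auto
  with computable_if_zero[OF assms[unfolded decidable_def]] show ?thesis by simp
qed

lemma decidable_eq_zero: "computable f \<Longrightarrow> decidable (\<lambda>x. f x = 0)"
  unfolding decidable_def by (intro computable_if_zero computable_const)

lemma decidable_eq:
  assumes "computable f" and "computable g"
  shows "decidable (\<lambda>x. f x = g x)"
proof -
  have "decidable (\<lambda>x. (f x - g x) + (g x - f x) = 0)"
    by (intro decidable_eq_zero computable_add computable_diff assms)
  moreover have "(f x - g x) + (g x - f x) = 0 \<longleftrightarrow> f x = g x" for x by auto
  ultimately show ?thesis by simp
qed

lemma decidable_less: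
  assumes "computable f" and "computable g"
  shows "decidable (\<lambda>x. f x < g x)"
proof -
  have "decidable (\<lambda>x. Suc (f x) - g x = 0)"
    by (intro decidable_eq_zero computable_Suc computable_diff assms)
  moreover have "Suc (f x) - g x = 0 \<longleftrightarrow> f x < g x" for x by auto
  ultimately show ?thesis by simp
qed

lemma decidable_conj:
  assumes "decidable P" and "decidable Q"
  shows "decidable (\<lambda>x. P x \<and> Q x)"
proof -
  have "computable (\<lambda>x. if P x then if Q x then 0 else 1 else 1)"
    by (intro computable_if assms computable_const)
  moreover have "(\<lambda>x. if P x then if Q x then 0 else 1 else 1) = (\<lambda>x. if P x \<and> Q x then 0 else 1::nat)"
    by auto
  ultimately show ?thesis unfolding decidable_def by simp
qed

lemma decidable_disj:
  assumes "decidable P" and "decidable Q"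
  shows "decidable (\<lambda>x. P x \<or> Q x)"
proof -
  have "computable (\<lambda>x. if P x then 0 else if Q x then 0 else 1)"
    by (intro computable_if assms computable_const)
  moreover have "(\<lambda>x. if P x then 0 else if Q x then 0 else 1) = (\<lambda>x. if P x \<or> Q x then 0 else 1::nat)"
    by auto
  ultimately show ?thesis unfolding decidable_def by simp
qed

text \<open>Truth is coded by 0, which is what \<open>Mu\<close> searches for. The tested function
  is total, so the condition in \<open>Mu\<close> that smaller arguments converge always
  holds.\<close>

lemma minimization:
  assumes "decidable (\<lambda>x. Q (fst (prod_decode x)) (snd (prod_decode x)))"
  shows "\<exists>c. \<forall>x. eval_prog c x = (if \<exists>z. Q x z then Some (LEAST z. Q x z) else None)"
proof -
  obtain c where "\<And>x. eval_prog c x = Some (if Q (fst (prod_decode x)) (snd (prod_decode x)) then 0 else 1)"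
    using assms unfolding decidable_def computable_def by blast
  then have "\<forall>x. eval_prog (Mu c) x = (if \<exists>z. Q x z then Some (LEAST z. Q x z) else None)"
    by (simp add: Let_def)
  then show ?thesis by blast
qed

lemma W_prog_num: "W (prog_num c) = dom (eval_prog c)"
  by (simp add: W_def inj_prog_num)

text \<open>Prefixing the \<open>e\<close>-th program with a fixed one is computable in \<open>e\<close>, so no universal
  program is needed to form the preimage of \<^term>\<open>W e\<close> under a partial computable map.\<close>

lemma computable_preimage:
  "\<exists>r. computable r \<and> (\<forall>e x. x \<in> W (r e) \<longleftrightarrow> (\<exists>k\<in>W e. eval_prog c x = Some k))"
proof (intro exI conjI allI)
  let ?r = "\<lambda>e. prog_num (Comp (inv prog_num e) c)"
  have surj: "prog_num (inv prog_num e) = e" for e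
    by (simp add: surj_prog_num surj_f_inv_f)
  \<comment> \<open>By the numbering of \<open>Comp\<close>, the index of the composite is 5 plus
    four times this pair. The multiple is written with sums, which are known to be
    computable.\<close>
  let ?q = "\<lambda>e. prod_encode (e, prog_num c)"
  have "computable (\<lambda>e. 5 + ((?q e + ?q e) + (?q e + ?q e)))"
    by (intro computable_add computable_const computable_pair computable_id)
  moreover have "(\<lambda>e. 5 + ((?q e + ?q e) + (?q e + ?q e))) = ?r"
    by (simp add: surj fun_eq_iff)
  ultimately show "computable ?r" by simp
  show "x \<in> W (?r e) \<longleftrightarrow> (\<exists>k\<in>W e. eval_prog c x = Some k)" for e x
    unfolding W_prog_num by (auto simp: W_def dom_def bind_eq_Some_conv)
qed


section \<open>The lexicographic order on \<open>\<nat>\<^sup>n\<close>\<close>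

text \<open>Coordinate \<open>n - 1\<close> is compared first, since it will be the coefficient of
  the highest power of omega. Coordinates from \<open>n\<close> on are ignored, so on functions this
  is only a preorder.\<close>

primrec lexle :: "nat \<Rightarrow> (nat \<Rightarrow> nat) \<Rightarrow> (nat \<Rightarrow> nat) \<Rightarrow> bool" where
  "lexle 0 f g \<longleftrightarrow> True"
| "lexle (Suc n) f g \<longleftrightarrow> f n < g n \<or> f n = g n \<and> lexle n f g"

lemma lexle_refl: "lexle n f f"
  by (induction n) simp_all

lemma lexle_trans: "lexle n f g \<Longrightarrow> lexle n g k \<Longrightarrow> lexle n f k"
  by (induction n) auto

lemma lexle_total: "lexle n f g \<or> lexle n g f"
  by (induction n) auto

lemma lexle_antisym: "lexle n f g \<Longrightarrow> lexle n g f \<Longrightarrow> i < n \<Longrightarrow> f i = g i"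
  by (induction n) (auto simp: less_Suc_eq)

lemma lexle_cong:
  "(\<And>i. i < n \<Longrightarrow> f i = f' i) \<Longrightarrow> (\<And>i. i < n \<Longrightarrow> g i = g' i) \<Longrightarrow> lexle n f g \<longleftrightarrow> lexle n f' g'"
  by (induction n) simp_all

lemma lexle_add: "lexle n (\<lambda>i. f i + k i) (\<lambda>i. g i + k i) \<longleftrightarrow> lexle n f g"
  by (induction n) simp_all

lemma lexle_mono: "(\<And>i. i < n \<Longrightarrow> f i \<le> g i) \<Longrightarrow> lexle n f g"
  by (induction n) (auto simp: le_less)

text \<open>Minimize the top coordinate, then apply induction to the vectors attaining that
  minimum.\<close>

lemma lexle_least:
  assumes "F \<noteq> {}"
  shows "\<exists>f\<in>F. \<forall>g\<in>F. lexle n f g"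
  using assms
proof (induction n arbitrary: F)
  case 0
  then show ?case by auto
next
  case (Suc n)
  define k where "k = (LEAST k. \<exists>f\<in>F. f n = k)"
  have k: "\<exists>f\<in>F. f n = k"
    unfolding k_def by (rule LeastI_ex) (use Suc.prems in blast)
  then have "{f \<in> F. f n = k} \<noteq> {}" by blast
  from Suc.IH[OF this] obtain f where f: "f \<in> F" "f n = k" "\<And>g. g \<in> F \<Longrightarrow> g n = k \<Longrightarrow> lexle n f g"
    by blast
  have "k \<le> g n" if "g \<in> F" for g
    unfolding k_def by (rule Least_le) (use that in blast)
  with f show ?case by (intro bexI[of _ f]) (fastforce simp: le_less)+
qed

section \<open>Coefficient vectors as Cantor normal forms\<close>

primrec cnf_of :: "nat \<Rightarrow> (nat \<Rightarrow> nat) \<Rightarrow> cnf" where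
  "cnf_of 0 f = []"
| "cnf_of (Suc n) f = (if f n = 0 then cnf_of n f else (n, f n) # cnf_of n f)"

lemma cnf_of_fst_less: "x \<in> set (cnf_of n f) \<Longrightarrow> fst x < n"
  by (induction n) (auto split: if_splits)

lemma cnf_of_cong: "(\<And>i. i < n \<Longrightarrow> f i = g i) \<Longrightarrow> cnf_of n f = cnf_of n g"
  by (induction n) simp_all

lemma is_cnf_cnf_of: "is_cnf (cnf_of n f)"
  by (induction n) (auto simp: is_cnf_def dest: cnf_of_fst_less)

lemma ord_less_Cons:
  "ord_less (x # a) (y # b) \<longleftrightarrow>
    fst x < fst y \<or> fst x = fst y \<and> snd x < snd y \<or> x = y \<and> ord_less a b"
  unfolding ord_less_def by (cases x; cases y) auto

lemma ord_less_Nil: "ord_less [] b \<longleftrightarrow> b \<noteq> []" "\<not> ord_less a []"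
  unfolding ord_less_def by (cases b; simp; fail) simp

lemma ord_less_head: "(\<And>x. x \<in> set a \<Longrightarrow> fst x < k) \<Longrightarrow> ord_less a ((k, c) # b)"
  by (cases a) (auto simp: ord_less_Cons ord_less_Nil)

lemma not_ord_le_head: "(\<And>x. x \<in> set a \<Longrightarrow> fst x < k) \<Longrightarrow> \<not> ord_le ((k, c) # b) a"
  by (cases a) (force simp: ord_le_def ord_less_Cons ord_less_Nil)+

text \<open>If only one top coefficient vanishes, that normal form has all exponents below
  \<open>n\<close> and lies below any list headed by exponent \<open>n\<close>. Otherwise the heads
  are compared as in \<open>lexle\<close>, or both are absent.\<close>

lemma ord_le_cnf_of: "ord_le (cnf_of n f) (cnf_of n g) \<longleftrightarrow> lexle n f g"
proof (induction n)
  case 0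
  then show ?case by (simp add: ord_le_def)
next
  case (Suc n)
  have "ord_less (cnf_of n a) ((n, c) # b)" "\<not> ord_le ((n, c) # b) (cnf_of n a)" for a b c
    by (rule ord_less_head not_ord_le_head; erule cnf_of_fst_less)+
  with Suc show ?case by (auto simp: ord_le_def ord_less_Cons)
qed

lemma cnf_of_surj:
  assumes "is_cnf a" and "\<And>x. x \<in> set a \<Longrightarrow> fst x < n"
  shows "\<exists>f. a = cnf_of n f"
  using assms
proof (induction n arbitrary: a)
  case 0
  then show ?case by (cases a) auto
next
  case (Suc n)
  show ?case
  proof (cases "a \<noteq> [] \<and> fst (hd a) = n")
    case True
    then obtain c b where a: "a = (n, c) # b" by (cases a) auto
    with Suc.prems have "is_cnf b" "c > 0" "\<And>x. x \<in> set b \<Longrightarrow> fst x < n"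
      by (auto simp: is_cnf_def)
    with Suc.IH obtain f where f: "b = cnf_of n f" by blast
    have "a = cnf_of (Suc n) (f(n := c))"
      using \<open>c > 0\<close> by (simp add: a f) (rule cnf_of_cong, simp)
    then show ?thesis by blast
  next
    case False
    \<comment> \<open>Exponents decrease strictly along the list, so a head exponent other than
      \<open>n\<close> keeps \<open>n\<close> out of the whole list.\<close>
    have "fst x < n" if "x \<in> set a" for x
      using Suc.prems that False by (cases a) (fastforce simp: is_cnf_def less_Suc_eq)+
    with Suc.IH Suc.prems obtain f where f: "a = cnf_of n f" by blast
    have "a = cnf_of (Suc n) (f(n := 0))"
      by (simp add: f) (rule cnf_of_cong, simp)
    then show ?thesis by blast
  qed
qed

lemma ordinals_below_omega_pow: "ordinals_below (omega_pow n) = range (cnf_of n)"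
proof (intro set_eqI iffI)
  fix a assume "a \<in> range (cnf_of n)"
  then show "a \<in> ordinals_below (omega_pow n)"
    by (auto simp: ordinals_below_def omega_pow_def is_cnf_cnf_of intro: ord_less_head dest: cnf_of_fst_less)
next
  fix a assume a: "a \<in> ordinals_below (omega_pow n)"
  \<comment> \<open>A head exponent \<open>n\<close> would need a coefficient below 1, which
    positivity excludes.\<close>
  have "fst x < n" if "x \<in> set a" for x
    using a that
    by (cases a) (fastforce simp: ordinals_below_def omega_pow_def is_cnf_def ord_less_Cons ord_less_Nil)+
  with a cnf_of_surj[of a n] show "a \<in> range (cnf_of n)"
    by (auto simp: ordinals_below_def)
qed


section \<open>Terms and exponent vectors\<close>

text \<open>This is the exponent vector, that is, the image of the term in the free commutative
  semigroup.\<close>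

primrec cnt :: "sterm \<Rightarrow> nat \<Rightarrow> nat" where
  "cnt (Var j) = (\<lambda>i. if i = j then 1 else 0)"
| "cnt (Times s t) = (\<lambda>i. cnt s i + cnt t i)"

primrec deg :: "sterm \<Rightarrow> nat" where
  "deg (Var j) = 1"
| "deg (Times s t) = deg s + deg t"

lemma Var_terms_over [simp]: "Var i \<in> terms_over n \<longleftrightarrow> i < n"
  by (simp add: terms_over_def)

lemma Times_terms_over [simp]: "Times s t \<in> terms_over n \<longleftrightarrow> s \<in> terms_over n \<and> t \<in> terms_over n"
  by (simp add: terms_over_def)

lemma deg_pos: "deg t > 0"
  by (induction t) auto

lemma cnt_eq_0: "t \<in> terms_over n \<Longrightarrow> n \<le> i \<Longrightarrow> cnt t i = 0"
  by (induction t) auto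

lemma deg_eq_sum_cnt: "t \<in> terms_over n \<Longrightarrow> deg t = (\<Sum>i<n. cnt t i)"
  by (induction t) (auto simp: sum.distrib)

lemma deg_eq_if_cnt_eq:
  "s \<in> terms_over n \<Longrightarrow> t \<in> terms_over n \<Longrightarrow> cnt s = cnt t \<Longrightarrow> deg s = deg t"
  by (simp add: deg_eq_sum_cnt)

lemma deg_1_iff: "deg t = 1 \<longleftrightarrow> (\<exists>i. t = Var i)"
proof (cases t)
  case (Times a b)
  with deg_pos[of a] deg_pos[of b] show ?thesis by auto
qed simp

lemma finite_terms_deg: "finite {t \<in> terms_over n. deg t \<le> d}"
proof (induction d)
  case 0
  have "{t \<in> terms_over n. deg t \<le> 0} = {}" using deg_pos by auto
  then show ?case by (metis finite.emptyI)
next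
  case (Suc d)
  let ?T = "{t \<in> terms_over n. deg t \<le> d}"
  have "t \<in> Var ` {..<n} \<union> (\<lambda>(a, b). Times a b) ` (?T \<times> ?T)"
    if "t \<in> terms_over n" "deg t \<le> Suc d" for t
  proof (cases t)
    case (Times a b)
    with that deg_pos[of a] deg_pos[of b] have "(a, b) \<in> ?T \<times> ?T" by auto
    with Times show ?thesis by force
  qed (use that in auto)
  then have "{t \<in> terms_over n. deg t \<le> Suc d} \<subseteq> Var ` {..<n} \<union> (\<lambda>(a, b). Times a b) ` (?T \<times> ?T)"
    by blast
  then show ?case
    by (rule finite_subset) (use Suc in simp)
qed

text \<open>A monomial of degree at least 2 splits off a variable. This will show that terms of
  large degree lie in high powers of the semigroup.\<close>

lemma cnt_split:
  "t \<in> terms_over n \<Longrightarrow>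
    (\<exists>i. t = Var i) \<or> (\<exists>s\<in>terms_over n. \<exists>i<n. cnt t = cnt (Times s (Var i)))"
proof (induction t)
  case (Times a b)
  then consider i where "b = Var i" "i < n"
    | s i where "s \<in> terms_over n" "i < n" "cnt b = cnt (Times s (Var i))"
    by fastforce
  then show ?case
  proof cases
    case 1
    with Times.prems show ?thesis by auto
  next
    case 2
    with Times.prems have "Times a s \<in> terms_over n" "cnt (Times a b) = cnt (Times (Times a s) (Var i))"
      by (auto simp: fun_eq_iff)
    with \<open>i < n\<close> show ?thesis by blast
  qed
qed simp

section \<open>Consequences of the commutative semigroup laws\<close>

lemma congruence_onD:
  assumes "congruence_on n r"
  shows "s \<in> terms_over n \<Longrightarrow> (s, s) \<in> r" "(s, t) \<in> r \<Longrightarrow> (t, s) \<in> r"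
    "(s, t) \<in> r \<Longrightarrow> (t, u) \<in> r \<Longrightarrow> (s, u) \<in> r"
    "(s, s') \<in> r \<Longrightarrow> (t, t') \<in> r \<Longrightarrow> (Times s t, Times s' t') \<in> r"
    "equiv (terms_over n) r"
  using assms unfolding congruence_on_def equiv_def
  by (auto dest: refl_onD symD transD)

text \<open>An occurring variable can be moved to the end: reassociate if it occurs in the right
  factor, otherwise commute first. A lone variable leaves nothing in front of it, hence the first
  alternative.\<close>

lemma CS_move_last:
  assumes r: "congruence_on n r" and laws: "CS_laws n \<subseteq> r" and t: "t \<in> terms_over n"
    and i: "cnt t i > 0"
  shows "t = Var i \<or>
    (\<exists>s\<in>terms_over n. (t, Times s (Var i)) \<in> r \<and> cnt t = cnt (Times s (Var i)))"
  using t i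
proof (induction t)
  case (Var j)
  then show ?case by (auto split: if_splits)
next
  note r = congruence_onD[OF r]
  case (Times a b)
  have ab: "a \<in> terms_over n" "b \<in> terms_over n" using Times.prems by simp_all
  \<comment> \<open>The factors are arbitrary because this is applied to \<open>Times a b\<close>
    and to \<open>Times b a\<close>.\<close>
  have last: "\<exists>s\<in>terms_over n. (Times u v, Times s (Var i)) \<in> r \<and> cnt (Times u v) = cnt (Times s (Var i))"
    if uv: "u \<in> terms_over n" "v \<in> terms_over n"
      and v: "v = Var i \<or> (\<exists>s\<in>terms_over n. (v, Times s (Var i)) \<in> r \<and> cnt v = cnt (Times s (Var i)))"
    for u v
    using v
  proof (elim disjE bexE conjE)
    assume "v = Var i"
    with uv r(1)[of "Times u v"] show ?thesis by auto
  next
    fix s assume s: "s \<in> terms_over n" "(v, Times s (Var i)) \<in> r" "cnt v = cnt (Times s (Var i))"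
    have "i < n"
      using s(2) equiv_type[OF r(5)] by auto
    then have "(Times (Times u s) (Var i), Times u (Times s (Var i))) \<in> r"
      using laws uv s by (auto simp: CS_laws_def)
    with r(4)[OF r(1)[OF uv(1)] s(2)] have "(Times u v, Times (Times u s) (Var i)) \<in> r"
      using r(2,3) by blast
    moreover have "cnt (Times u v) = cnt (Times (Times u s) (Var i))"
      using s(3) by (simp add: fun_eq_iff)
    ultimately show ?thesis using uv(1) s(1) by (metis Times_terms_over)
  qed
  show ?case
  proof (cases "cnt b i > 0")
    case True
    with Times.IH(2) ab last show ?thesis by blast
  next
    case False
    with Times.prems have "cnt a i > 0" by simp
    with Times.IH(1) ab last[of b a] obtain s
      where s: "s \<in> terms_over n" "(Times b a, Times s (Var i)) \<in> r"
        "cnt (Times b a) = cnt (Times s (Var i))" by blast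
    have "(Times a b, Times b a) \<in> r" using laws ab by (auto simp: CS_laws_def)
    moreover have "cnt (Times a b) = cnt (Times b a)" by (simp add: add.commute)
    ultimately show ?thesis using s r(3) by metis
  qed
qed

text \<open>Induction on the degree: move a common variable to the end of both terms and remove
  it.\<close>

lemma CS_cnt:
  assumes r: "congruence_on n r" and laws: "CS_laws n \<subseteq> r"
    and "s \<in> terms_over n" "t \<in> terms_over n" "cnt s = cnt t"
  shows "(s, t) \<in> r"
  using assms(3-)
proof (induction "deg s" arbitrary: s t rule: less_induct)
  case less
  note rr = congruence_onD[OF r]
  have deg: "deg s = deg t" by (rule deg_eq_if_cnt_eq) (use less.prems in auto)
  show ?case
  proof (cases "deg s = 1")
    case True
    with deg obtain i j where "s = Var i" "t = Var j" by (metis deg_1_iff)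
    with less.prems have "s = t" by (auto simp: fun_eq_iff split: if_splits)
    with rr(1) less.prems show ?thesis by simp
  next
    case False
    have "(\<Sum>i<n. cnt s i) \<noteq> 0"
      using deg_eq_sum_cnt[OF less.prems(1)] deg_pos[of s] by linarith
    then obtain i where i: "i < n" "cnt s i > 0"
      using sum.neutral[of "{..<n}" "cnt s"] by auto
    have "s \<noteq> Var i" "t \<noteq> Var i" using False deg by auto
    with CS_move_last[OF r laws] less.prems i obtain s' t' where
      s': "s' \<in> terms_over n" "(s, Times s' (Var i)) \<in> r" "cnt s = cnt (Times s' (Var i))" and
      t': "t' \<in> terms_over n" "(t, Times t' (Var i)) \<in> r" "cnt t = cnt (Times t' (Var i))"
      by metis
    have "deg s = deg (Times s' (Var i))"
      by (rule deg_eq_if_cnt_eq) (use less.prems s' i in auto)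
    then have "deg s' < deg s" by simp
    moreover have "cnt s' = cnt t'"
      using less.prems(3) s'(3) t'(3) by (simp add: fun_eq_iff)
    ultimately have "(s', t') \<in> r" using less.hyps s' t' by blast
    then have "(Times s' (Var i), Times t' (Var i)) \<in> r" using rr(1,4) i by simp
    with s' t' rr(2,3) show ?thesis by metis
  qed
qed


section \<open>The presentations\<close>

primrec times_pow :: "sterm \<Rightarrow> nat \<Rightarrow> nat \<Rightarrow> sterm" where
  "times_pow t i 0 = t"
| "times_pow t i (Suc c) = Times (times_pow t i c) (Var i)"

text \<open>The product is accumulated onto a given term because there is no empty term to start
  from.\<close>

primrec times_monomial :: "sterm \<Rightarrow> nat \<Rightarrow> (nat \<Rightarrow> nat) \<Rightarrow> sterm" where
  "times_monomial t 0 f = t"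
| "times_monomial t (Suc n) f = times_pow (times_monomial t n f) n (f n)"

lemma cnt_times_pow: "cnt (times_pow t i c) j = cnt t j + (if j = i then c else 0)"
  by (induction c) auto

lemma cnt_times_monomial: "cnt (times_monomial t n f) j = cnt t j + (if j < n then f j else 0)"
  by (induction n) (auto simp: cnt_times_pow)

lemma times_pow_terms_over: "t \<in> terms_over n \<Longrightarrow> i < n \<Longrightarrow> times_pow t i c \<in> terms_over n"
  by (induction c) auto

lemma times_monomial_terms_over:
  "t \<in> terms_over n \<Longrightarrow> k \<le> n \<Longrightarrow> times_monomial t k f \<in> terms_over n"
  by (induction k) (auto intro: times_pow_terms_over)

lemma times_monomial_cong:
  "(\<And>i. i < n \<Longrightarrow> f i = g i) \<Longrightarrow> times_monomial t n f = times_monomial t n g"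
  by (induction n) simp_all

text \<open>The ordinal with coefficients \<open>f\<close> is represented by the monomial with exponents \<open>f\<close> times
  the variable of highest rank. The extra factor provides for the ordinal \<open>0\<close>, since the empty
  monomial is not a term.\<close>

abbreviation ord_term :: "nat \<Rightarrow> (nat \<Rightarrow> nat) \<Rightarrow> sterm" where
  "ord_term m f \<equiv> times_monomial (Var m) (Suc m) f"

lemma ord_term_terms_over: "ord_term m f \<in> terms_over (Suc m)"
  by (rule times_monomial_terms_over) simp_all

section \<open>Lexicographic ideals and their Rees congruences\<close>

definition lex_ideal :: "nat \<Rightarrow> (nat \<Rightarrow> nat) set \<Rightarrow> sterm set" where
  "lex_ideal m F = {t \<in> terms_over (Suc m). \<exists>f\<in>F. lexle (Suc m) (cnt (ord_term m f)) (cnt t)}"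

text \<open>This is the congruence of the Rees quotient of the free commutative semigroup by the
  ideal, pulled back to terms.\<close>

definition rees :: "nat \<Rightarrow> (nat \<Rightarrow> nat) set \<Rightarrow> (sterm \<times> sterm) set" where
  "rees m F = {(s, t). s \<in> terms_over (Suc m) \<and> t \<in> terms_over (Suc m) \<and>
     (cnt s = cnt t \<or> s \<in> lex_ideal m F \<and> t \<in> lex_ideal m F)}"

text \<open>Only the left vector has to come from \<open>F\<close>. A pair can therefore be
  enumerated as soon as its left vector appears in \<open>F\<close>.\<close>

definition rees_gens :: "nat \<Rightarrow> (nat \<Rightarrow> nat) set \<Rightarrow> (sterm \<times> sterm) set" where
  "rees_gens m F = {(ord_term m f, ord_term m g) | f g. f \<in> F \<and> lexle (Suc m) f g}"

text \<open>The extra factor \<open>Var m\<close> translates both exponent vectors by the same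
  amount.\<close>

lemma lexle_ord_term: "lexle (Suc m) (cnt (ord_term m f)) (cnt (ord_term m g)) \<longleftrightarrow> lexle (Suc m) f g"
proof -
  have "lexle (Suc m) (cnt (ord_term m f)) (cnt (ord_term m g)) \<longleftrightarrow>
      lexle (Suc m) (\<lambda>i. f i + cnt (Var m) i) (\<lambda>i. g i + cnt (Var m) i)"
    by (rule lexle_cong) (simp_all only: cnt_times_monomial, simp_all)
  then show ?thesis by (simp only: lexle_add)
qed

lemma ord_term_in_lex_ideal: "ord_term m g \<in> lex_ideal m F \<longleftrightarrow> (\<exists>f\<in>F. lexle (Suc m) f g)"
  unfolding lex_ideal_def using lexle_ord_term ord_term_terms_over by blast

lemma lex_ideal_upward:
  "s \<in> lex_ideal m F \<Longrightarrow> t \<in> terms_over (Suc m) \<Longrightarrow> lexle (Suc m) (cnt s) (cnt t) \<Longrightarrow> t \<in> lex_ideal m F"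
  unfolding lex_ideal_def using lexle_trans by blast

lemma lex_ideal_cnt:
  "s \<in> terms_over (Suc m) \<Longrightarrow> t \<in> terms_over (Suc m) \<Longrightarrow> cnt s = cnt t \<Longrightarrow>
    s \<in> lex_ideal m F \<longleftrightarrow> t \<in> lex_ideal m F"
  by (simp add: lex_ideal_def)

text \<open>Both sets are upward closed for a total preorder.\<close>

lemma lex_ideal_chain: "lex_ideal m F \<subseteq> lex_ideal m G \<or> lex_ideal m G \<subseteq> lex_ideal m F"
proof (rule ccontr)
  assume "\<not> ?thesis"
  then obtain s t where "s \<in> lex_ideal m F" "s \<notin> lex_ideal m G" "t \<in> lex_ideal m G" "t \<notin> lex_ideal m F"
    by blast
  moreover from this have "s \<in> terms_over (Suc m)" "t \<in> terms_over (Suc m)"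
    by (simp_all add: lex_ideal_def)
  ultimately show False
    using lexle_total[of "Suc m" "cnt s" "cnt t"] lex_ideal_upward by blast
qed

lemma lex_ideal_Times:
  assumes "s \<in> lex_ideal m F" and "t \<in> terms_over (Suc m)"
  shows "Times s t \<in> lex_ideal m F" "Times t s \<in> lex_ideal m F"
proof -
  have "s \<in> terms_over (Suc m)" using assms by (simp add: lex_ideal_def)
  with assms show "Times s t \<in> lex_ideal m F" "Times t s \<in> lex_ideal m F"
    by (auto intro!: lex_ideal_upward[OF assms(1)] lexle_mono simp del: lexle.simps)
qed

lemma rees_lex_ideal: "(s, t) \<in> rees m F \<Longrightarrow> s \<in> lex_ideal m F \<longleftrightarrow> t \<in> lex_ideal m F"
  unfolding rees_def using lex_ideal_cnt[of s m t F] by blast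

text \<open>A product with a factor in the ideal stays in the ideal; for factors outside it, equal
  exponent vectors add up to equal ones.\<close>

lemma congruence_on_rees: "congruence_on (Suc m) (rees m F)"
  unfolding congruence_on_def
proof (intro conjI allI impI)
  show "equiv (terms_over (Suc m)) (rees m F)"
  proof (rule equivI)
    show "rees m F \<subseteq> terms_over (Suc m) \<times> terms_over (Suc m)" "refl_on (terms_over (Suc m)) (rees m F)"
      by (auto simp: rees_def refl_on_def)
    show "sym (rees m F)" by (auto simp: rees_def sym_def)
    show "trans (rees m F)"
    proof (rule transI)
      fix s t u assume *: "(s, t) \<in> rees m F" "(t, u) \<in> rees m F"
      with rees_lex_ideal have "s \<in> lex_ideal m F \<longleftrightarrow> t \<in> lex_ideal m F" "t \<in> lex_ideal m F \<longleftrightarrow> u \<in> lex_ideal m F"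
        by blast+
      with * show "(s, u) \<in> rees m F" by (auto simp: rees_def)
    qed
  qed
  fix s s' t t' assume *: "(s, s') \<in> rees m F \<and> (t, t') \<in> rees m F"
  with rees_lex_ideal have "s \<in> lex_ideal m F \<longleftrightarrow> s' \<in> lex_ideal m F" "t \<in> lex_ideal m F \<longleftrightarrow> t' \<in> lex_ideal m F"
    by blast+
  with * show "(Times s t, Times s' t') \<in> rees m F"
    by (auto simp: rees_def intro: lex_ideal_Times)
qed

text \<open>Up to the laws, every term of the ideal is some \<open>ord_term m g\<close> with
  \<open>g\<close> above an element \<open>f\<close> of \<open>F\<close>, so a generator links it to
  \<open>ord_term m f\<close>. Terms for two elements of \<open>F\<close> are linked because the
  order is total.\<close>

lemma rees_subset:
  assumes r: "congruence_on (Suc m) r" and laws: "CS_laws (Suc m) \<subseteq> r" and gens: "rees_gens m F \<subseteq> r"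
  shows "rees m F \<subseteq> r"
proof -
  note rr = congruence_onD[OF r]
  have gen: "\<exists>f\<in>F. (ord_term m f, s) \<in> r" if s: "s \<in> lex_ideal m F" for s
  proof -
    from s obtain f where f: "f \<in> F" and le: "lexle (Suc m) (cnt (ord_term m f)) (cnt s)"
      and sT: "s \<in> terms_over (Suc m)"
      by (auto simp: lex_ideal_def)
    \<comment> \<open>This divides out the extra factor \<open>Var m\<close>. The top coordinate
      dominates the order and is at least 1 for \<open>ord_term m f\<close>, hence also for
      \<open>s\<close>, so the truncated subtraction is exact.\<close>
    define g where "g i = cnt s i - cnt (Var m) i" for i
    have "cnt (ord_term m f) m \<le> cnt s m" using le by auto
    then have "cnt s m > 0" by (simp add: cnt_times_monomial del: times_monomial.simps)
    then have g: "cnt (ord_term m g) = cnt s"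
      using cnt_eq_0[OF sT] by (simp only: fun_eq_iff cnt_times_monomial) (auto simp: g_def)
    then have "lexle (Suc m) f g" using le lexle_ord_term by metis
    with f gens have "(ord_term m f, ord_term m g) \<in> r" by (auto simp: rees_gens_def)
    moreover have "(ord_term m g, s) \<in> r"
      by (rule CS_cnt[OF r laws ord_term_terms_over sT g])
    ultimately show ?thesis using f rr(3) by blast
  qed
  have "(ord_term m f, ord_term m g) \<in> r" if "f \<in> F" "g \<in> F" for f g
    using that lexle_total[of "Suc m" f g] gens rr(2) unfolding rees_gens_def by blast
  with gen rr(2,3) have "(s, t) \<in> r" if "s \<in> lex_ideal m F" "t \<in> lex_ideal m F" for s t
    using that by meson
  then show ?thesis
    using CS_cnt[OF r laws] by (auto simp: rees_def)
qed

lemma CS_laws_rees: "CS_laws (Suc m) \<subseteq> rees m F"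
  by (auto simp: CS_laws_def rees_def fun_eq_iff)

lemma rees_gens_rees: "rees_gens m F \<subseteq> rees m F"
  unfolding rees_gens_def rees_def
  using ord_term_terms_over ord_term_in_lex_ideal lexle_refl lexle_trans by blast

lemma CS_cong_rees:
  assumes "coded_pairs (Suc m) p e = rees_gens m F"
  shows "CS_cong (Suc m) p e = rees m F"
proof
  show "CS_cong (Suc m) p e \<subseteq> rees m F"
    unfolding CS_cong_def assms
    using congruence_on_rees CS_laws_rees rees_gens_rees by blast
  show "rees m F \<subseteq> CS_cong (Suc m) p e"
    unfolding CS_cong_def assms by (rule Inter_greatest) (use rees_subset in blast)
qed


section \<open>The isomorphism invariant\<close>

text \<open>The index is shifted: \<open>products A f d\<close> is the power of \<open>A\<close>
  with exponent \<open>d + 1\<close>.\<close>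

primrec products :: "'a set \<Rightarrow> ('a \<Rightarrow> 'a \<Rightarrow> 'a) \<Rightarrow> nat \<Rightarrow> 'a set" where
  "products A f 0 = A"
| "products A f (Suc d) = {f x y | x y. x \<in> products A f d \<and> y \<in> A}"

text \<open>An isomorphism carries each power onto the corresponding power and, being injective,
  respects their differences.\<close>

lemma card_products_diff:
  assumes iso: "semigroup_isomorphic A f B g" and closed: "\<And>x y. x \<in> A \<Longrightarrow> y \<in> A \<Longrightarrow> f x y \<in> A"
  shows "card (products A f d - products A f (Suc d)) = card (products B g d - products B g (Suc d))"
proof -
  obtain \<phi> where bij: "bij_betw \<phi> A B" and hom: "\<And>x y. x \<in> A \<Longrightarrow> y \<in> A \<Longrightarrow> \<phi> (f x y) = g (\<phi> x) (\<phi> y)"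
    using iso unfolding semigroup_isomorphic_def by blast
  have sub: "products A f k \<subseteq> A" for k
    by (induction k) (auto intro: closed)
  have img: "\<phi> ` products A f k = products B g k" for k
  proof (induction k)
    case 0
    show ?case using bij by (simp add: bij_betw_def)
  next
    case (Suc k)
    show ?case
    proof (intro equalityI subsetI)
      fix z assume "z \<in> \<phi> ` products A f (Suc k)"
      then obtain x y where xy: "x \<in> products A f k" "y \<in> A" "z = \<phi> (f x y)" by auto
      moreover have "x \<in> A" using xy(1) sub by blast
      ultimately have "z = g (\<phi> x) (\<phi> y)" "\<phi> x \<in> products B g k" "\<phi> y \<in> B"
        using hom Suc bij by (auto simp: bij_betw_def)
      then show "z \<in> products B g (Suc k)" by auto
    next
      fix z assume "z \<in> products B g (Suc k)"
      then obtain u v where uv: "z = g u v" "u \<in> \<phi> ` products A f k" "v \<in> \<phi> ` A"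
        using Suc bij by (auto simp: bij_betw_def)
      then obtain x y where xy: "x \<in> products A f k" "u = \<phi> x" "y \<in> A" "v = \<phi> y" by blast
      moreover have "x \<in> A" using xy(1) sub by blast
      ultimately have "z = \<phi> (f x y)" using uv(1) hom by simp
      then show "z \<in> \<phi> ` products A f (Suc k)" using xy(1,3) by auto
    qed
  qed
  have inj: "inj_on \<phi> A" using bij by (simp add: bij_betw_def)
  have "\<phi> ` (products A f d - products A f (Suc d)) = products B g d - products B g (Suc d)"
    unfolding img[symmetric] by (rule inj_on_image_set_diff[OF inj]) (use sub[of d] sub[of "Suc d"] in auto)
  moreover have "inj_on \<phi> (products A f d - products A f (Suc d))"
    by (rule inj_on_subset[OF inj]) (use sub[of d] in auto)
  ultimately show ?thesis using card_image by fastforce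
qed

text \<open>The set of pairs \<open>(f x, g x)\<close> projects injectively onto both
  images.\<close>

lemma card_image_eq_if_same_kernel:
  assumes "\<And>x y. x \<in> N \<Longrightarrow> y \<in> N \<Longrightarrow> f x = f y \<longleftrightarrow> g x = g y"
  shows "card (f ` N) = card (g ` N)"
proof -
  have "inj_on fst ((\<lambda>x. (f x, g x)) ` N)" "inj_on snd ((\<lambda>x. (f x, g x)) ` N)"
    using assms by (auto simp: inj_on_def)
  from this[THEN card_image] show ?thesis by (simp add: image_image)
qed

definition rees_class :: "nat \<Rightarrow> (nat \<Rightarrow> nat) set \<Rightarrow> sterm \<Rightarrow> sterm set" where
  "rees_class m F t = rees m F `` {t}"

lemma rees_class_eq_iff:
  "s \<in> terms_over (Suc m) \<Longrightarrow> t \<in> terms_over (Suc m) \<Longrightarrow>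
    rees_class m F s = rees_class m F t \<longleftrightarrow> (s, t) \<in> rees m F"
  unfolding rees_class_def by (rule eq_equiv_class_iff[OF congruence_onD(5)[OF congruence_on_rees]])

lemma rees_class_eqI: "(s, t) \<in> rees m F \<Longrightarrow> rees_class m F s = rees_class m F t"
  unfolding rees_class_def by (rule equiv_class_eq[OF congruence_onD(5)[OF congruence_on_rees]])

section \<open>Powers of the presented semigroup\<close>

context
  fixes m :: nat and F :: "(nat \<Rightarrow> nat) set" and p :: "sterm \<times> sterm \<Rightarrow> nat" and e :: nat
  assumes cong: "CS_cong (Suc m) p e = rees m F"
begin

abbreviation "cls \<equiv> rees_class m F"

lemma CS_carrier_eq: "CS_carrier (Suc m) p e = cls ` terms_over (Suc m)"
  by (auto simp: CS_carrier_def cong quotient_def rees_class_def)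

lemma CS_mult_cls:
  assumes "s \<in> terms_over (Suc m)" and "t \<in> terms_over (Suc m)"
  shows "CS_mult (Suc m) p e (cls s) (cls t) = cls (Times s t)"
proof -
  note r = congruence_onD[OF congruence_on_rees[of m F]]
  have mem: "u' \<in> cls u \<longleftrightarrow> (u, u') \<in> rees m F" for u u'
    by (simp add: rees_class_def)
  have "cls (Times s' t') = cls (Times s t)" if "s' \<in> cls s" "t' \<in> cls t" for s' t'
    by (rule rees_class_eqI[symmetric], rule r(4)) (use that mem in simp_all)
  then have "CS_mult (Suc m) p e (cls s) (cls t) = (\<Union>s'\<in>cls s. \<Union>t'\<in>cls t. cls (Times s t))"
    unfolding CS_mult_def cong rees_class_def[symmetric] by simp
  \<comment> \<open>The union of copies of one class is that class only because both index sets are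
    nonempty.\<close>
  moreover have "s \<in> cls s" "t \<in> cls t" using assms r(1) mem by simp_all
  ultimately show ?thesis by auto
qed

text \<open>Degrees add up in products, and conversely \<open>cnt_split\<close> peels off one
  variable. The degree need not be constant on a class, so the powers are described as
  images.\<close>

lemma products_CS:
  "products (CS_carrier (Suc m) p e) (CS_mult (Suc m) p e) d = cls ` {t \<in> terms_over (Suc m). deg t \<ge> Suc d}"
proof (induction d)
  case 0
  have "deg t \<ge> Suc 0" for t using deg_pos[of t] by simp
  then show ?case by (simp add: CS_carrier_eq)
next
  case (Suc d)
  have image: "{f x y | x y. x \<in> k ` A \<and> y \<in> k ` B} = {f (k s) (k t) | s t. s \<in> A \<and> t \<in> B}"
    for f :: "sterm set \<Rightarrow> sterm set \<Rightarrow> sterm set" and k :: "sterm \<Rightarrow> sterm set" and A B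
    by blast
  have "products (CS_carrier (Suc m) p e) (CS_mult (Suc m) p e) (Suc d) =
      {CS_mult (Suc m) p e (cls s) (cls t) | s t. s \<in> terms_over (Suc m) \<and> deg s \<ge> Suc d \<and> t \<in> terms_over (Suc m)}"
    unfolding products.simps Suc unfolding CS_carrier_eq image by (simp only: mem_Collect_eq conj_assoc)
  also have "\<dots> = {cls (Times s t) | s t. s \<in> terms_over (Suc m) \<and> deg s \<ge> Suc d \<and> t \<in> terms_over (Suc m)}"
    by (intro Collect_cong ex_cong1) (metis CS_mult_cls)
  also have "\<dots> = cls ` {t \<in> terms_over (Suc m). deg t \<ge> Suc (Suc d)}"
  proof (intro equalityI subsetI)
    fix x assume "x \<in> {cls (Times s t) | s t. s \<in> terms_over (Suc m) \<and> deg s \<ge> Suc d \<and> t \<in> terms_over (Suc m)}"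
    then obtain s t where st: "x = cls (Times s t)" "s \<in> terms_over (Suc m)" "deg s \<ge> Suc d" "t \<in> terms_over (Suc m)" by blast
    have "deg (Times s t) \<ge> Suc (Suc d)" using st(3) deg_pos[of t] by simp
    with st show "x \<in> cls ` {t \<in> terms_over (Suc m). deg t \<ge> Suc (Suc d)}" by (intro image_eqI[of _ _ "Times s t"]) simp_all
  next
    fix x assume "x \<in> cls ` {t \<in> terms_over (Suc m). deg t \<ge> Suc (Suc d)}"
    then obtain t where t: "x = cls t" "t \<in> terms_over (Suc m)" "deg t \<ge> Suc (Suc d)" by blast
    then have "deg t \<noteq> 1" by simp
    with cnt_split[OF t(2)] obtain s i where s: "s \<in> terms_over (Suc m)" "i < Suc m" "cnt t = cnt (Times s (Var i))"
      by (auto simp: deg_1_iff)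
    have "deg t = deg (Times s (Var i))"
      by (rule deg_eq_if_cnt_eq) (use s t in auto)
    with t have "deg s \<ge> Suc d" by simp
    moreover have "(t, Times s (Var i)) \<in> rees m F"
      using s t(2) by (simp add: rees_def)
    then have "cls t = cls (Times s (Var i))"
      by (rule rees_class_eqI)
    ultimately show "x \<in> {cls (Times s t) | s t. s \<in> terms_over (Suc m) \<and> deg s \<ge> Suc d \<and> t \<in> terms_over (Suc m)}"
      using s(1,2) t(1) by (intro CollectI exI[of _ s] exI[of _ "Var i"]) simp
  qed
  finally show ?case .
qed

text \<open>The zero class, if present, lies in every power and drops out. Outside the ideal a class
  determines its exponent vector and so its degree.\<close>

lemma card_products_CS:
  "card (products (CS_carrier (Suc m) p e) (CS_mult (Suc m) p e) d -
         products (CS_carrier (Suc m) p e) (CS_mult (Suc m) p e) (Suc d)) =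
   card (cnt ` {t \<in> terms_over (Suc m) - lex_ideal m F. deg t = Suc d})" (is "card ?D = card (cnt ` ?N)")
proof -
  have "?D = cls ` ?N"
  proof (intro equalityI subsetI)
    fix x assume x: "x \<in> ?D"
    then obtain t where t: "x = cls t" "t \<in> terms_over (Suc m)" "deg t \<ge> Suc d"
      unfolding products_CS by blast
    have notin: "cls t \<noteq> cls s" if "s \<in> terms_over (Suc m)" "deg s \<ge> Suc (Suc d)" for s
      using x that unfolding products_CS t(1) by blast
    have "\<not> deg t \<ge> Suc (Suc d)" using notin[of t] t(2) by blast
    with t(3) have "deg t = Suc d" by simp
    moreover have "t \<notin> lex_ideal m F"
    proof
      assume "t \<in> lex_ideal m F"
      \<comment> \<open>A term of the ideal is congruent to its square, whose degree is large enough
        to put the class into the next power.\<close>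
      with t(2) lex_ideal_Times(1)[of t m F t] have "(t, Times t t) \<in> rees m F" by (simp add: rees_def)
      then have "cls t = cls (Times t t)"
        by (rule rees_class_eqI)
      with notin[of "Times t t"] t show False by simp
    qed
    ultimately show "x \<in> cls ` ?N" using t by blast
  next
    fix x assume "x \<in> cls ` ?N"
    then obtain t where t: "x = cls t" "t \<in> terms_over (Suc m)" "t \<notin> lex_ideal m F" "deg t = Suc d" by blast
    have "cls t \<noteq> cls s" if "s \<in> terms_over (Suc m)" "deg s \<ge> Suc (Suc d)" for s
    proof
      assume "cls t = cls s"
      with t that have "(t, s) \<in> rees m F" using rees_class_eq_iff[of t m s F] by blast
      with t have "cnt t = cnt s" by (simp add: rees_def)
      with deg_eq_if_cnt_eq[of t "Suc m" s] that t show False by simp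
    qed
    with t show "x \<in> ?D" unfolding products_CS by auto
  qed
  moreover have "card (cls ` ?N) = card (cnt ` ?N)"
  proof (rule card_image_eq_if_same_kernel)
    fix s t assume st: "s \<in> ?N" "t \<in> ?N"
    then have "cls s = cls t \<longleftrightarrow> (s, t) \<in> rees m F" by (intro rees_class_eq_iff) simp_all
    with st show "cls s = cls t \<longleftrightarrow> cnt s = cnt t" by (simp add: rees_def)
  qed
  ultimately show ?thesis by simp
qed

lemma CS_mult_closed:
  "x \<in> CS_carrier (Suc m) p e \<Longrightarrow> y \<in> CS_carrier (Suc m) p e \<Longrightarrow>
    CS_mult (Suc m) p e x y \<in> CS_carrier (Suc m) p e"
  by (auto simp: CS_carrier_eq CS_mult_cls)

end

text \<open>Equal ideals give the same congruence. Conversely, isomorphism equates the numbers of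
  monomials of each degree outside the ideals; for comparable ideals and finite counts this forces
  equality.\<close>

lemma CS_iso_rees:
  assumes e: "CS_cong (Suc m) p e = rees m F" and i: "CS_cong (Suc m) p i = rees m G"
  shows "CS_iso (Suc m) p e i \<longleftrightarrow> lex_ideal m F = lex_ideal m G"
proof
  assume "lex_ideal m F = lex_ideal m G"
  then have "CS_cong (Suc m) p e = CS_cong (Suc m) p i" by (simp add: e i rees_def)
  then have "CS_carrier (Suc m) p e = CS_carrier (Suc m) p i" "CS_mult (Suc m) p e = CS_mult (Suc m) p i"
    by (simp_all add: CS_carrier_def CS_mult_def fun_eq_iff)
  then show "CS_iso (Suc m) p e i"
    unfolding CS_iso_def semigroup_isomorphic_def by (intro exI[of _ id]) simp
next
  assume iso: "CS_iso (Suc m) p e i"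
  let ?N = "\<lambda>F d. {t \<in> terms_over (Suc m) - lex_ideal m F. deg t = Suc d}"
  have card: "card (cnt ` ?N F d) = card (cnt ` ?N G d)" for d
    using card_products_diff[OF iso[unfolded CS_iso_def] CS_mult_closed[OF e]]
      card_products_CS[OF e] card_products_CS[OF i] by simp
  have fin: "finite (cnt ` ?N K d)" for K d
    by (rule finite_imageI, rule finite_subset[OF _ finite_terms_deg[of "Suc m" "Suc d"]]) auto
  \<comment> \<open>The complements are nested as well, so in each degree one finite set of exponent
    vectors contains another of the same size.\<close>
  have sub: "lex_ideal m A \<subseteq> lex_ideal m B"
    if BA: "lex_ideal m B \<subseteq> lex_ideal m A"
      and card: "\<And>d. card (cnt ` ?N A d) = card (cnt ` ?N B d)" for A B
  proof
    fix t assume t: "t \<in> lex_ideal m A"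
    then have tT: "t \<in> terms_over (Suc m)" by (simp add: lex_ideal_def)
    have "cnt ` ?N A d \<subseteq> cnt ` ?N B d" for d using BA by blast
    then have eq: "cnt ` ?N A d = cnt ` ?N B d" for d
      by (rule card_subset_eq[OF fin _ card])
    obtain d where d: "deg t = Suc d" using deg_pos[of t] by (cases "deg t") auto
    show "t \<in> lex_ideal m B"
    proof (rule ccontr)
      assume "t \<notin> lex_ideal m B"
      with tT d have "cnt t \<in> cnt ` ?N B d" by simp
      then have "cnt t \<in> cnt ` ?N A d" by (simp only: eq)
      then obtain s where "s \<in> ?N A d" "cnt t = cnt s" by (elim imageE)
      with lex_ideal_cnt[of t m s A] t tT show False by simp
    qed
  qed
  show "lex_ideal m F = lex_ideal m G"
    using lex_ideal_chain[of m F G] sub[OF _ card] sub[OF _ card[symmetric]]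
    by (elim disjE) (simp_all add: subset_antisym)
qed


section \<open>Computing the presentations\<close>

text \<open>\<open>coord i z\<close> is the \<open>i\<close>-th component of the infinite tuple coded by \<open>z\<close>. Since \<open>n\<close> is
  fixed, every function of the first \<open>n\<close> components is handled by recursion on \<open>n\<close> outside of
  the programs.\<close>

primrec coord :: "nat \<Rightarrow> nat \<Rightarrow> nat" where
  "coord 0 z = fst (prod_decode z)"
| "coord (Suc i) z = coord i (snd (prod_decode z))"

lemma coord_surj: "\<exists>z. \<forall>i<n. coord i z = f i"
proof (induction n arbitrary: f)
  case (Suc n)
  from Suc[of "\<lambda>i. f (Suc i)"] obtain z where z: "\<forall>i<n. coord i z = f (Suc i)" by blast
  have "coord i (prod_encode (f 0, z)) = f i" if "i < Suc n" for i
    using that z by (cases i) auto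
  then show ?case by blast
qed simp

lemma computable_coord: "computable a \<Longrightarrow> computable (\<lambda>x. coord i (a x))"
  by (induction i arbitrary: a) (auto intro: computable_fst computable_snd)

lemma decidable_lexle:
  assumes "computable a" and "computable b"
  shows "decidable (\<lambda>x. lexle n (\<lambda>i. coord i (a x)) (\<lambda>i. coord i (b x)))"
proof (induction n)
  case 0
  show ?case unfolding decidable_def by (simp add: computable_const)
next
  case (Suc n)
  then show ?case unfolding lexle.simps
    by (intro decidable_disj decidable_conj decidable_less decidable_eq computable_coord assms)
qed

lemma cnf_num_Cons: "cnf_num ((k, c) # a) = Suc (prod_encode (k, Suc (prod_encode (c, cnf_num a))))"
  by (simp add: cnf_num_def)

lemma computable_cnf_of:
  assumes "computable a"
  shows "computable (\<lambda>x. cnf_num (cnf_of n (\<lambda>i. coord i (a x))))"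
proof (induction n)
  case 0
  show ?case by (simp add: computable_const)
next
  case (Suc n)
  have "computable (\<lambda>x. if coord n (a x) = 0 then cnf_num (cnf_of n (\<lambda>i. coord i (a x)))
      else Suc (prod_encode (n, Suc (prod_encode (coord n (a x), cnf_num (cnf_of n (\<lambda>i. coord i (a x))))))))"
    by (intro computable_if_zero computable_Suc computable_pair computable_const computable_coord Suc assms)
  moreover have "cnf_num (cnf_of (Suc n) f) = (if f n = 0 then cnf_num (cnf_of n f)
      else Suc (prod_encode (n, Suc (prod_encode (f n, cnf_num (cnf_of n f))))))" for f
    by (simp add: cnf_num_Cons)
  ultimately show ?case by (simp only:)
qed

lemma computable_times_pow:
  assumes "computable a" and "computable (\<lambda>x. sterm_num (t x))"
  shows "computable (\<lambda>x. sterm_num (times_pow (t x) i (a x)))"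
proof -
  \<comment> \<open>Here \<open>2 * i\<close> is the number of \<open>Var i\<close>, and
    \<open>Suc (?s r + ?s r)\<close> is the number of a term with number \<open>r\<close> times
    \<open>Var i\<close>.\<close>
  let ?s = "\<lambda>r. prod_encode (r, 2 * i)"
  have "computable (\<lambda>x. rec_nat (sterm_num (t x)) (\<lambda>_ r. Suc (?s r + ?s r)) (a x))"
    by (intro computable_rec assms computable_Suc computable_add computable_pair computable_snd
        computable_const computable_id)
  moreover have "rec_nat (sterm_num u) (\<lambda>_ r. Suc (?s r + ?s r)) c = sterm_num (times_pow u i c)" for u c
    by (induction c) simp_all
  ultimately show ?thesis by simp
qed

lemma computable_times_monomial:
  assumes "computable a"
  shows "computable (\<lambda>x. sterm_num (times_monomial t n (\<lambda>i. coord i (a x))))"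
  by (induction n) (simp_all add: computable_const computable_times_pow computable_coord assms)

text \<open>From a coded pair, search for vectors producing it and output the number of the left
  ordinal; the search diverges on pairs of any other shape. The required set is the preimage of
  \<open>W e\<close> under this partial map.\<close>

lemma computable_presentation:
  assumes h: "computable_bijection cnf_num (ordinals_below (omega_pow (Suc m))) h"
    and p: "computable_bijection sterm_pair_num (terms_over (Suc m) \<times> terms_over (Suc m)) p"
  shows "\<exists>r. computable r \<and>
    (\<forall>e. coded_pairs (Suc m) p (r e) = rees_gens m {f. h (cnf_of (Suc m) f) \<in> W e})"
proof -
  let ?n = "Suc m"
  obtain fh where fh: "computable fh" "\<And>f. h (cnf_of ?n f) = fh (cnf_num (cnf_of ?n f))"
    using h unfolding computable_bijection_def ordinals_below_omega_pow by (metis rangeI)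
  obtain fp where fp: "computable fp"
    "\<And>s t. s \<in> terms_over ?n \<Longrightarrow> t \<in> terms_over ?n \<Longrightarrow> p (s, t) = fp (prod_encode (sterm_num s, sterm_num t))"
    using p unfolding computable_bijection_def sterm_pair_num_def by fastforce
  have inj: "inj_on p (terms_over ?n \<times> terms_over ?n)"
    using p unfolding computable_bijection_def bij_betw_def by blast
  define v where "v z i = coord i z" for z i
  define w1 where "w1 z = v (fst (prod_decode z))" for z
  define w2 where "w2 z = v (snd (prod_decode z))" for z
  \<comment> \<open>The number \<open>z\<close> codes two vectors, and \<open>Q\<close> says that
    they yield a generator pair with code \<open>q\<close>.\<close>
  define Q where "Q q z \<longleftrightarrow> lexle ?n (w1 z) (w2 z) \<and> p (ord_term m (w1 z), ord_term m (w2 z)) = q" for q z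
  have v_surj: "\<exists>z. \<forall>i<?n. v z i = f i" for f
    unfolding v_def by (rule coord_surj)
  have "decidable (\<lambda>x. Q (fst (prod_decode x)) (snd (prod_decode x)))"
    unfolding Q_def w1_def w2_def v_def fp(2)[OF ord_term_terms_over ord_term_terms_over]
    by (intro decidable_conj decidable_lexle decidable_eq computable_comp[OF fp(1)] computable_pair
        computable_times_monomial computable_fst computable_snd computable_id)
  from minimization[OF this] obtain c where
    c: "\<And>q. eval_prog c q = (if \<exists>z. Q q z then Some (LEAST z. Q q z) else None)" by blast
  have "computable (\<lambda>z. h (cnf_of ?n (w1 z)))"
    unfolding fh(2) w1_def v_def
    by (intro computable_comp[OF fh(1)] computable_cnf_of computable_fst computable_id)
  then obtain d where d: "\<And>z. eval_prog d z = Some (h (cnf_of ?n (w1 z)))"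
    unfolding computable_def by blast
  obtain r where r: "computable r"
    "\<And>e x. x \<in> W (r e) \<longleftrightarrow> (\<exists>k\<in>W e. eval_prog (Comp d c) x = Some k)"
    using computable_preimage by blast
  have "coded_pairs ?n p (r e) = rees_gens m {f. h (cnf_of ?n f) \<in> W e}" for e
  proof (intro equalityI subsetI)
    fix q assume "q \<in> coded_pairs ?n p (r e)"
    then have q: "q \<in> terms_over ?n \<times> terms_over ?n" and "p q \<in> W (r e)"
      by (auto simp: coded_pairs_def)
    then obtain k where k: "k \<in> W e" "eval_prog (Comp d c) (p q) = Some k" using r(2) by blast
    then have "\<exists>z. Q (p q) z" by (cases "\<exists>z. Q (p q) z") (simp_all add: c)
    define z where "z = (LEAST z. Q (p q) z)"
    have Qz: "Q (p q) z" unfolding z_def by (rule LeastI_ex) fact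
    have "h (cnf_of ?n (w1 z)) \<in> W e" using k \<open>\<exists>z. Q (p q) z\<close>
      by (simp add: c d z_def del: cnf_of.simps)
    moreover have "q = (ord_term m (w1 z), ord_term m (w2 z))"
      by (rule inj_onD[OF inj]) (use Qz q ord_term_terms_over in \<open>simp_all add: Q_def del: times_monomial.simps\<close>)
    ultimately show "q \<in> rees_gens m {f. h (cnf_of ?n f) \<in> W e}"
      using Qz unfolding Q_def rees_gens_def by blast
  next
    fix q assume "q \<in> rees_gens m {f. h (cnf_of ?n f) \<in> W e}"
    then obtain f g where fg: "q = (ord_term m f, ord_term m g)" "h (cnf_of ?n f) \<in> W e" "lexle ?n f g"
      unfolding rees_gens_def by blast
    obtain a b where ab: "\<forall>i<?n. v a i = f i" "\<forall>i<?n. v b i = g i"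
      using v_surj by blast
    have terms: "ord_term m (v a) = ord_term m f" "ord_term m (v b) = ord_term m g"
      by (rule times_monomial_cong; use ab in blast)+
    have "lexle ?n (v a) (v b)"
      using fg(3) lexle_cong[of ?n "v a" f "v b" g] ab by blast
    then have "Q (p q) (prod_encode (a, b))"
      by (simp add: Q_def w1_def w2_def fg(1) terms del: lexle.simps times_monomial.simps)
    then have ex: "\<exists>z. Q (p q) z" ..
    define z where "z = (LEAST z. Q (p q) z)"
    have Qz: "Q (p q) z" unfolding z_def by (rule LeastI_ex) fact
    \<comment> \<open>The search may stop at a code other than that of \<open>(a, b)\<close>.
      Injectivity of \<open>p\<close> and comparison of exponents still give the values of
      \<open>f\<close> below \<open>Suc m\<close>, hence the same ordinal.\<close>
    have "(ord_term m (w1 z), ord_term m (w2 z)) = q"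
      by (rule inj_onD[OF inj])
        (use Qz fg(1) ord_term_terms_over in \<open>simp_all add: Q_def del: times_monomial.simps\<close>)
    then have "cnt (ord_term m (w1 z)) i = cnt (ord_term m f) i" for i
      using fg(1) by (simp del: times_monomial.simps)
    then have "(if i < ?n then w1 z i else 0) = (if i < ?n then f i else 0)" for i
      by (simp only: cnt_times_monomial add_left_cancel)
    then have "w1 z i = f i" if "i < ?n" for i
      using that by presburger
    then have "cnf_of ?n (w1 z) = cnf_of ?n f" by (rule cnf_of_cong)
    then have "eval_prog (Comp d c) (p q) = Some (h (cnf_of ?n f))"
      using ex by (simp add: c d z_def del: cnf_of.simps)
    with fg(2) r(2) have "p q \<in> W (r e)" by blast
    then show "q \<in> coded_pairs ?n p (r e)"
      using fg(1) ord_term_terms_over by (simp add: coded_pairs_def del: times_monomial.simps)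
  qed
  with r(1) show ?thesis by blast
qed


section \<open>Least elements\<close>

definition lex_least :: "nat \<Rightarrow> (nat \<Rightarrow> nat) set \<Rightarrow> (nat \<Rightarrow> nat) \<Rightarrow> bool" where
  "lex_least n F f \<longleftrightarrow> f \<in> F \<and> (\<forall>g\<in>F. lexle n f g)"

lemma lex_least_exists: "F \<noteq> {} \<Longrightarrow> \<exists>f. lex_least n F f"
  unfolding lex_least_def Bex_def[symmetric] by (rule lexle_least)

lemma lex_ideal_least:
  assumes "lex_least (Suc m) F f"
  shows "lex_ideal m F = lex_ideal m {f}"
proof (intro equalityI subsetI)
  fix t assume "t \<in> lex_ideal m F"
  then obtain g where g: "t \<in> terms_over (Suc m)" "g \<in> F" "lexle (Suc m) (cnt (ord_term m g)) (cnt t)"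
    unfolding lex_ideal_def by blast
  with assms have "lexle (Suc m) (cnt (ord_term m f)) (cnt (ord_term m g))"
    unfolding lexle_ord_term lex_least_def by blast
  with g show "t \<in> lex_ideal m {f}"
    unfolding lex_ideal_def using lexle_trans[of "Suc m" "cnt (ord_term m f)"] by blast
qed (use assms in \<open>auto simp: lex_ideal_def lex_least_def simp del: lexle.simps times_monomial.simps\<close>)

lemma lex_ideal_empty_iff: "lex_ideal m F = {} \<longleftrightarrow> F = {}"
proof
  assume "lex_ideal m F = {}"
  then show "F = {}" using ord_term_in_lex_ideal[of m _ F] lexle_refl by blast
qed (simp add: lex_ideal_def)

text \<open>Least elements of \<open>F\<close> and \<open>G\<close> with equal ideals agree only
  below \<open>Suc m\<close>. The closure assumption on \<open>G\<close> lets one function serve for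
  both sets.\<close>

lemma lex_ideal_eq_iff:
  assumes closed: "\<And>f g. f \<in> G \<Longrightarrow> (\<And>k. k < Suc m \<Longrightarrow> g k = f k) \<Longrightarrow> g \<in> G"
  shows "lex_ideal m F = lex_ideal m G \<longleftrightarrow>
    F = {} \<and> G = {} \<or> (\<exists>f. lex_least (Suc m) F f \<and> lex_least (Suc m) G f)"
proof
  assume eq: "lex_ideal m F = lex_ideal m G"
  then have empty: "F = {} \<longleftrightarrow> G = {}"
    by (simp only: lex_ideal_empty_iff[of m, symmetric])
  show "F = {} \<and> G = {} \<or> (\<exists>f. lex_least (Suc m) F f \<and> lex_least (Suc m) G f)"
  proof (cases "F = {}")
    case True
    with empty show ?thesis by blast
  next
    case False
    with empty have "G \<noteq> {}" by blast
    from lex_least_exists[OF False, of "Suc m"] lex_least_exists[OF this, of "Suc m"]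
    obtain f g where f: "lex_least (Suc m) F f" and g: "lex_least (Suc m) G g" by (elim exE)
    have "lex_ideal m {f} = lex_ideal m {g}"
      using eq unfolding lex_ideal_least[OF f] lex_ideal_least[OF g] .
    \<comment> \<open>Testing the ideals on the terms of \<open>f\<close> and \<open>g\<close>
      themselves gives both inequalities.\<close>
    then have "ord_term m k \<in> lex_ideal m {f} \<longleftrightarrow> ord_term m k \<in> lex_ideal m {g}" for k
      by (simp only:)
    then have "lexle (Suc m) f k \<longleftrightarrow> lexle (Suc m) g k" for k
      by (simp only: ord_term_in_lex_ideal bex_simps ball_simps simp_thms)
    from this[of f] this[of g] have le: "lexle (Suc m) f g" "lexle (Suc m) g f"
      by (simp_all only: lexle_refl simp_thms)
    have "g \<in> G" using g by (simp add: lex_least_def)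
    then have "f \<in> G"
      by (rule closed) (rule lexle_antisym[OF le])
    moreover have "lexle (Suc m) f k" if "k \<in> G" for k
      using lexle_trans[OF le(1), of k] g that by (simp only: lex_least_def)
    ultimately have "lex_least (Suc m) G f"
      by (simp only: lex_least_def) blast
    with f show ?thesis by blast
  qed
next
  assume "F = {} \<and> G = {} \<or> (\<exists>f. lex_least (Suc m) F f \<and> lex_least (Suc m) G f)"
  then show "lex_ideal m F = lex_ideal m G"
    using lex_ideal_least[of m F] lex_ideal_least[of m G] by (elim disjE exE conjE) simp_all
qed

text \<open>The map from \<open>f\<close> to \<open>h (cnf_of (Suc m) f)\<close> is onto the numbers
  and turns \<open>lexle\<close> into the order induced by \<open>h\<close>, so least elements can
  be sought among vectors.\<close>

lemma E_min_lex_ideal: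
  assumes bij: "bij_betw h (ordinals_below (omega_pow (Suc m))) UNIV"
  shows "E_min (omega_pow (Suc m)) h e i \<longleftrightarrow>
    lex_ideal m {f. h (cnf_of (Suc m) f) \<in> W e} = lex_ideal m {f. h (cnf_of (Suc m) f) \<in> W i}"
proof -
  define c where "c f = cnf_of (Suc m) f" for f
  define F where "F e = {f. h (c f) \<in> W e}" for e
  let ?D = "ordinals_below (omega_pow (Suc m))"
  have D: "?D = range c" unfolding c_def by (rule ordinals_below_omega_pow)
  have inv: "inv_into ?D h (h (c f)) = c f" for f
    by (rule inv_into_f_f) (use bij D in \<open>auto simp: bij_betw_def\<close>)
  have surj: "\<exists>f. k = h (c f)" for k
    using bij unfolding bij_betw_def D by blast
  have all: "(\<forall>k\<in>A. P k) \<longleftrightarrow> (\<forall>g. h (c g) \<in> A \<longrightarrow> P (h (c g)))" for A P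
  proof (intro iffI ballI)
    fix k assume *: "\<forall>g. h (c g) \<in> A \<longrightarrow> P (h (c g))" "k \<in> A"
    obtain g where "k = h (c g)" using surj by blast
    with * show "P k" by simp
  qed simp
  have le: "ord_le (c f) (c g) \<longleftrightarrow> lexle (Suc m) f g" for f g
    unfolding c_def by (rule ord_le_cnf_of)
  have least: "is_least_via (omega_pow (Suc m)) h (W e) (h (c f)) \<longleftrightarrow> lex_least (Suc m) (F e) f" for e f
    unfolding is_least_via_def le_via_def all lex_least_def F_def inv le Ball_def mem_Collect_eq ..
  have empty: "W e = {} \<longleftrightarrow> F e = {}" for e
    using all[of "W e" "\<lambda>_. False"] unfolding F_def by auto
  have "(\<exists>k. is_least_via (omega_pow (Suc m)) h (W e) k \<and> is_least_via (omega_pow (Suc m)) h (W i) k) \<longleftrightarrow>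
      (\<exists>f. lex_least (Suc m) (F e) f \<and> lex_least (Suc m) (F i) f)"
    unfolding least[symmetric]
  proof
    assume "\<exists>k. is_least_via (omega_pow (Suc m)) h (W e) k \<and> is_least_via (omega_pow (Suc m)) h (W i) k"
    then obtain k where k: "is_least_via (omega_pow (Suc m)) h (W e) k" "is_least_via (omega_pow (Suc m)) h (W i) k"
      by blast
    obtain f where "k = h (c f)" using surj by blast
    with k show "\<exists>f. is_least_via (omega_pow (Suc m)) h (W e) (h (c f)) \<and>
        is_least_via (omega_pow (Suc m)) h (W i) (h (c f))" by blast
  qed blast
  moreover have "lex_ideal m (F e) = lex_ideal m (F i) \<longleftrightarrow>
      F e = {} \<and> F i = {} \<or> (\<exists>f. lex_least (Suc m) (F e) f \<and> lex_least (Suc m) (F i) f)"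
  proof (rule lex_ideal_eq_iff)
    fix f g assume "f \<in> F i" and "\<And>k. k < Suc m \<Longrightarrow> g k = f k"
    moreover from this(2) have "c g = c f" unfolding c_def by (rule cnf_of_cong)
    ultimately show "g \<in> F i" by (simp add: F_def)
  qed
  ultimately have "E_min (omega_pow (Suc m)) h e i \<longleftrightarrow> lex_ideal m (F e) = lex_ideal m (F i)"
    unfolding E_min_def empty by (simp only:)
  then show ?thesis unfolding F_def c_def .
qed

theorem theorem4p7:
  fixes n :: nat
    and h :: "cnf \<Rightarrow> nat"
    and p :: "sterm \<times> sterm \<Rightarrow> nat"
  assumes "n \<ge> 2"
    and "computable_bijection cnf_num (ordinals_below (omega_pow n)) h"
    and "computable_bijection sterm_pair_num (terms_over n \<times> terms_over n) p"
  shows "E_min (omega_pow n) h \<le>\<^sub>c CS_iso n p"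
proof -
  \<comment> \<open>The variables are those of index at most \<open>m\<close>, and
    \<open>Var m\<close> is the one of highest rank.\<close>
  from \<open>n \<ge> 2\<close> obtain m where n: "n = Suc m" by (cases n) auto
  obtain r where r: "computable r"
    "\<And>e. coded_pairs n p (r e) = rees_gens m {f. h (cnf_of n f) \<in> W e}"
    using computable_presentation[of m h p] assms(2,3) unfolding n by blast
  have "E_min (omega_pow n) h e i \<longleftrightarrow> CS_iso n p (r e) (r i)" for e i
  proof -
    have "bij_betw h (ordinals_below (omega_pow (Suc m))) UNIV"
      using assms(2) by (simp add: n computable_bijection_def)
    from E_min_lex_ideal[OF this] CS_iso_rees[OF CS_cong_rees CS_cong_rees, OF r(2)[unfolded n] r(2)[unfolded n]]
    show ?thesis unfolding n by blast
  qed
  with r(1) show ?thesis unfolding computably_reducible_def by blast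
qed

end
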